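(* Suppose that one observes the Gaussian sequence model $Y(i)=f(i)+n^{-1/2}z_i$, $i=1,\ldots,n$, with $z_i$ i.i.d. $N(0,1)$, that $n\ge4$ and that $m_n<n^\gamma$ with $\gamma<\frac12$. Let $Tf=\sum_{i=1}^nf(i)$, let $0<\alpha<\frac12$, and let $\mathcal{G}=\{f\in\mathbb{R}^n:\|f\|_0\le m_n\}$. Suppose that $CI(Y)$ is a confidence interval for $Tf$ based on $Y$ and $CI(Y)\in\mathcal{I}_{\alpha,\mathcal{G}}$. Then for all sufficiently large $n$, $$E_0L(CI(Y))\ \ge\ \Big(\frac12-\alpha\Big)\frac{m_n}{\sqrt n}\sqrt{\frac12\log\Big(\frac n{m_n^2}\Big)}\ \ge\ \Big(\frac12-\alpha\Big)\sqrt{\frac14-\frac\gamma2}\cdot\omega\Big(\frac{\sqrt{\log k}}{\sqrt n},\mathcal{G}\Big),$$ where $k=\binom n{m_n}$ and $E_0$ denotes expectation under the model with $f(i)=0$ for $i=1,2,\ldots,n$.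
   Context: $m_n$ is a known positive integer for each $n$. $\|f\|_0=\mathrm{Card}(\{i:f(i)\ne0\})$. The set $\mathcal{G}$ is the union of the $k=\binom n{m_n}$ coordinate subspaces $\mathcal{F}_I=\{f\in\mathbb{R}^n:f(j)=0\ \forall j\notin I\}$, where $I$ ranges over the subsets of $\{1,\ldots,n\}$ with $m_n$ elements. A confidence interval $CI$ is a data-dependent interval, with length $L(CI)$. $\mathcal{I}_{\alpha,\mathcal{G}}$ is the collection of all confidence intervals with $\inf_{f\in\mathcal{G}}P_f(Tf\in CI)\ge1-\alpha$. Modulus of continuity: $\omega(\varepsilon,\mathcal{G})=\sup\{Tg-Tf:\|g-f\|_2\le\varepsilon,\ f,g\in\mathcal{G}\}$, where $\|\cdot\|_2$ is the Euclidean norm on $\mathbb{R}^n$. *)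

theory Defs
  imports "HOL-Probability.Probability"
begin

text \<open>Vectors in $\mathbb{R}^n$ are functions \<open>nat \<Rightarrow> real\<close> that are extensional on \<open>{1..n}\<close>,
  i.e. elements of the space of the product \<open>\<sigma>\<close>-algebra below.\<close>

definition vec_space :: "nat \<Rightarrow> (nat \<Rightarrow> real) measure" where
  "vec_space n = PiM {1..n} (\<lambda>_. borel)"

definition zero_vec :: "nat \<Rightarrow> nat \<Rightarrow> real" where
  "zero_vec n = (\<lambda>i\<in>{1..n}. 0)"

definition noise :: "nat \<Rightarrow> (nat \<Rightarrow> real) measure" where
  "noise n = PiM {1..n} (\<lambda>_. std_normal_distribution)"

text \<open>The law $P_f$ of the observation $Y(i) = f(i) + n^{-1/2} z_i$.\<close>

definition gaussian_seq :: "nat \<Rightarrow> (nat \<Rightarrow> real) \<Rightarrow> (nat \<Rightarrow> real) measure" where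
  "gaussian_seq n f =
     distr (noise n) (vec_space n) (\<lambda>z. \<lambda>i\<in>{1..n}. f i + real n powr (-1/2) * z i)"

definition l0_norm :: "nat \<Rightarrow> (nat \<Rightarrow> real) \<Rightarrow> nat" where
  "l0_norm n f = card {i \<in> {1..n}. f i \<noteq> 0}"

definition sparse_vecs :: "nat \<Rightarrow> nat \<Rightarrow> (nat \<Rightarrow> real) set" where
  "sparse_vecs n m = {f \<in> space (vec_space n). l0_norm n f \<le> m}"

definition sum_functional :: "nat \<Rightarrow> (nat \<Rightarrow> real) \<Rightarrow> real" where
  "sum_functional n f = (\<Sum>i=1..n. f i)"

text \<open>An interval may be open, closed, half-open, unbounded or empty. Measurability of the coverage
  events is what gives the coverage probabilities a meaning; it also implies that the length is a
  measurable function of the data (it is the supremum of $q - p$ over the rationals $p \le q$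
  that are covered).\<close>

definition data_intervals :: "nat \<Rightarrow> ((nat \<Rightarrow> real) \<Rightarrow> real set) set" where
  "data_intervals n = {CI.
     (\<forall>y\<in>space (vec_space n). is_interval (CI y)) \<and>
     (\<forall>t. {y \<in> space (vec_space n). t \<in> CI y} \<in> sets (vec_space n))}"

definition interval_length :: "real set \<Rightarrow> ennreal" where
  "interval_length S = emeasure lborel S"

definition confidence_intervals ::
  "nat \<Rightarrow> ((nat \<Rightarrow> real) \<Rightarrow> real) \<Rightarrow> real \<Rightarrow> (nat \<Rightarrow> real) set \<Rightarrow> ((nat \<Rightarrow> real) \<Rightarrow> real set) set" where
  "confidence_intervals n T \<alpha> G = {CI \<in> data_intervals n.
     (INF f\<in>G. measure (gaussian_seq n f) {y \<in> space (vec_space n). T f \<in> CI y}) \<ge> 1 - \<alpha>}"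

text \<open>The supremum is a real one; it is a genuine supremum for the functional at hand by the
  two lemmas that follow.\<close>

definition modulus :: "nat \<Rightarrow> ((nat \<Rightarrow> real) \<Rightarrow> real) \<Rightarrow> real \<Rightarrow> (nat \<Rightarrow> real) set \<Rightarrow> real" where
  "modulus n T \<epsilon> G =
     Sup {T g - T f | f g. f \<in> G \<and> g \<in> G \<and> L2_set (\<lambda>i. g i - f i) {1..n} \<le> \<epsilon>}"

lemma modulus_set_bdd_above:
  "bdd_above {sum_functional n g - sum_functional n f | f g.
     f \<in> G \<and> g \<in> G \<and> L2_set (\<lambda>i. g i - f i) {1..n} \<le> \<epsilon>}"
proof (rule bdd_aboveI, safe)
  fix f g :: "nat \<Rightarrow> real"
  assume le: "L2_set (\<lambda>i. g i - f i) {1..n} \<le> \<epsilon>"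
  have "g i - f i \<le> \<epsilon>" if "i \<in> {1..n}" for i
    using member_le_L2_set[of "{1..n}" i "\<lambda>i. g i - f i"] that le by simp
  then have "(\<Sum>i=1..n. g i - f i) \<le> (\<Sum>i=1..n. \<epsilon>)"
    by (intro sum_mono) auto
  then show "sum_functional n g - sum_functional n f \<le> real n * \<epsilon>"
    by (simp add: sum_functional_def sum_subtractf)
qed

lemma modulus_set_nonempty:
  assumes "\<epsilon> \<ge> 0"
  shows "{T g - T f | f g. f \<in> sparse_vecs n m \<and> g \<in> sparse_vecs n m \<and>
           L2_set (\<lambda>i. g i - f i) {1..n} \<le> \<epsilon>} \<noteq> {}"
proof -
  have "{i \<in> {1..n}. zero_vec n i \<noteq> 0} = {}"
    by (auto simp: zero_vec_def)
  then have "l0_norm n (zero_vec n) = 0"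
    unfolding l0_norm_def by (simp only: card.empty)
  moreover have "zero_vec n \<in> space (vec_space n)"
    by (auto simp: vec_space_def zero_vec_def space_PiM)
  ultimately have "zero_vec n \<in> sparse_vecs n m"
    by (simp add: sparse_vecs_def)
  then show ?thesis
    using assms by (auto simp: L2_set_def intro!: exI[of _ "zero_vec n"])
qed

end

theory Submission
  imports Defs
begin

text \<open>Put the prior on \<open>f\<close> that is uniform on the vectors \<open>\<theta> 1\<^sub>I\<close>, where \<open>card I = m\<close> and
  \<open>n \<theta>\<^sup>2 = ln (n / m\<^sup>2) / 2\<close>, so that \<open>Tf = m \<theta>\<close> almost surely. The likelihood ratio \<open>W\<close> of the
  mixture against \<open>P\<^sub>0\<close> has second moment \<open>E exp (n \<theta>\<^sup>2 card (I \<inter> J)) \<le> exp (m / sqrt n)\<close>, which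
  tends to \<open>1\<close>. Hence under \<open>P\<^sub>0\<close> the interval must cover both \<open>0\<close> and \<open>m \<theta>\<close> with probability at
  least \<open>1 - 2 \<alpha> - o(1) \<ge> 1/2 - \<alpha>\<close>, and then its length is at least \<open>m \<theta>\<close>. The second inequality
  follows from \<open>\<omega>(\<epsilon>) \<le> sqrt (2 m) \<epsilon>\<close> and \<open>ln k \<le> m ln n\<close>.\<close>

section \<open>The Gaussian observation law as a product measure\<close>

text \<open>The map from noise to data acts on each coordinate separately, so independence survives
  the pushforward. The product form lets densities be compared one coordinate at a time.\<close>

lemma gaussian_seq_eq_PiM:
  assumes "n > 0"
  shows "gaussian_seq n f =
    PiM {1..n} (\<lambda>i. density lborel (normal_density (f i) (1 / sqrt (real n))))"
proof -
  define c where "c = real n powr (-1/2)"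
  have c: "c = 1 / sqrt (real n)" "c > 0"
    using assms by (simp_all add: c_def powr_minus_divide powr_half_sqrt)
  let ?M = "\<lambda>i. density lborel (normal_density (f i) (1 / sqrt (real n)))"
  interpret N: prob_space std_normal_distribution
    by (rule prob_space_normal_density) simp
  have M: "prob_space (?M i)" for i
    using assms by (intro prob_space_normal_density) simp
  interpret P: product_sigma_finite ?M
    using M prob_space_imp_sigma_finite by (auto simp: product_sigma_finite_def)
  interpret Q: product_sigma_finite "\<lambda>_::nat. std_normal_distribution"
    using N.sigma_finite_measure_axioms by (auto simp: product_sigma_finite_def)
  \<comment> \<open>The identity serves as the standard normal variable whose affine image
    \<open>normal_density_affine\<close> describes.\<close>
  have d0: "distributed std_normal_distribution lborel (\<lambda>x. x) std_normal_density"
    unfolding distributed_def by (simp add: distr_id2)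
  have d: "distr std_normal_distribution borel (\<lambda>z. f i + c * z) = ?M i" for i
    using distributed_distr_eq_density[OF N.normal_density_affine[OF d0, of c "f i"]] c
    by (simp add: distr_cong[OF refl sets_lborel refl])
  have meas: "(\<lambda>z. \<lambda>i\<in>{1..n}. f i + c * z i) \<in> noise n \<rightarrow>\<^sub>M vec_space n"
    unfolding noise_def vec_space_def by measurable
  have sp: "space (noise n) = PiE {1..n} (\<lambda>_. UNIV)"
    by (simp add: noise_def space_PiM)
  show ?thesis
  proof (rule P.PiM_eqI)
    show "sets (gaussian_seq n f) = sets (PiM {1..n} ?M)"
      unfolding gaussian_seq_def vec_space_def by (simp cong: sets_PiM_cong)
    fix A assume "\<And>i. i \<in> {1..n} \<Longrightarrow> A i \<in> sets (?M i)"
    then have A: "\<And>i. i \<in> {1..n} \<Longrightarrow> A i \<in> sets borel" by simp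
    have A': "PiE {1..n} A \<in> sets (vec_space n)"
      unfolding vec_space_def by (rule sets_PiM_I_finite) (use A in auto)
    have "emeasure (gaussian_seq n f) (PiE {1..n} A)
        = emeasure (noise n) ((\<lambda>z. \<lambda>i\<in>{1..n}. f i + c * z i) -` PiE {1..n} A \<inter> space (noise n))"
      unfolding gaussian_seq_def c_def[symmetric] using meas A' by (rule emeasure_distr)
    also have "(\<lambda>z. \<lambda>i\<in>{1..n}. f i + c * z i) -` PiE {1..n} A \<inter> space (noise n)
        = PiE {1..n} (\<lambda>i. (\<lambda>z. f i + c * z) -` A i)"
      unfolding sp by (auto simp: PiE_iff)
    also have "emeasure (noise n) \<dots>
        = (\<Prod>i\<in>{1..n}. emeasure std_normal_distribution ((\<lambda>z. f i + c * z) -` A i))"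
      unfolding noise_def
    proof (rule Q.emeasure_PiM)
      fix i assume i: "i \<in> {1..n}"
      have "(\<lambda>z. f i + c * z) \<in> borel \<rightarrow>\<^sub>M borel" by measurable
      from measurable_sets[OF this A[OF i]]
      show "(\<lambda>z. f i + c * z) -` A i \<in> sets std_normal_distribution" by simp
    qed simp
    also have "\<dots> = (\<Prod>i\<in>{1..n}. emeasure (?M i) (A i))"
    proof (rule prod.cong[OF refl])
      fix i assume i: "i \<in> {1..n}"
      show "emeasure std_normal_distribution ((\<lambda>z. f i + c * z) -` A i) = emeasure (?M i) (A i)"
        unfolding d[symmetric] using A[OF i] by (subst emeasure_distr) auto
    qed
    finally show "emeasure (gaussian_seq n f) (PiE {1..n} A)
        = (\<Prod>i\<in>{1..n}. emeasure (?M i) (A i))" .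
  qed simp
qed

lemma sets_gaussian_seq [measurable_cong]: "sets (gaussian_seq n f) = sets (vec_space n)"
  by (simp add: gaussian_seq_def)

lemma space_gaussian_seq [simp]: "space (gaussian_seq n f) = space (vec_space n)"
  by (simp add: gaussian_seq_def)

lemma prob_space_gaussian_seq:
  assumes "n > 0"
  shows "prob_space (gaussian_seq n f)"
  unfolding gaussian_seq_eq_PiM[OF assms]
  by (intro prob_space_PiM prob_space_normal_density) (use assms in auto)

section \<open>Likelihood ratios against the zero signal and change of measure\<close>

text \<open>The Gaussian shift (Cameron-Martin) density of P_f against P_0 when each coordinate has
  noise variance 1/n. An explicit formula makes products of two ratios computable.\<close>

definition likelihood_ratio :: "nat \<Rightarrow> (nat \<Rightarrow> real) \<Rightarrow> (nat \<Rightarrow> real) \<Rightarrow> real" where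
  "likelihood_ratio n f y =
     exp (real n * (\<Sum>i=1..n. f i * y i) - real n / 2 * (\<Sum>i=1..n. (f i)\<^sup>2))"

lemma measurable_likelihood_ratio [measurable]:
  "likelihood_ratio n f \<in> borel_measurable (vec_space n)"
  unfolding likelihood_ratio_def vec_space_def by measurable

lemma likelihood_ratio_nonneg: "likelihood_ratio n f y \<ge> 0"
  by (simp add: likelihood_ratio_def)

text \<open>Both measures are compared on boxes, which determine a product measure; there the
  exponential splits into one factor per coordinate.\<close>

lemma gaussian_seq_density:
  assumes "n > 0"
  shows "gaussian_seq n f = density (gaussian_seq n (zero_vec n)) (likelihood_ratio n f)"
proof -
  let ?s = "1 / sqrt (real n)"
  let ?M = "\<lambda>i. density lborel (normal_density (f i) ?s)"
  let ?Z = "\<lambda>i. density lborel (normal_density (zero_vec n i) ?s)"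
  let ?r = "\<lambda>i y. exp (real n * (f i * y) - real n / 2 * (f i)\<^sup>2)"
  interpret P: product_sigma_finite ?M
    unfolding product_sigma_finite_def
    by (intro allI prob_space_imp_sigma_finite prob_space_normal_density) (use assms in simp)
  interpret Z: product_sigma_finite ?Z
    unfolding product_sigma_finite_def
    by (intro allI prob_space_imp_sigma_finite prob_space_normal_density) (use assms in simp)
  have r: "likelihood_ratio n f y = (\<Prod>i\<in>{1..n}. ?r i (y i))" for y
    by (simp add: likelihood_ratio_def exp_sum[symmetric] sum_subtractf sum_distrib_left)
  \<comment> \<open>With variance 1/n, expanding the square gives
    \<open>-n (x - f i)^2 / 2 = -n x^2 / 2 + n (f i) x - n (f i)^2 / 2\<close>.\<close>
  have tilt: "normal_density (f i) ?s x = normal_density 0 ?s x * ?r i x" for i x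
    using assms by (simp add: normal_density_def mult_exp_exp power_divide field_simps power2_eq_square)
  have "density (PiM {1..n} ?Z) (likelihood_ratio n f) = PiM {1..n} ?M"
  proof (rule P.PiM_eqI)
    show "sets (density (PiM {1..n} ?Z) (likelihood_ratio n f)) = sets (PiM {1..n} ?M)"
      by (simp cong: sets_PiM_cong)
    fix A assume "\<And>i. i \<in> {1..n} \<Longrightarrow> A i \<in> sets (?M i)"
    then have A: "\<And>i. i \<in> {1..n} \<Longrightarrow> A i \<in> sets borel" by simp
    have A': "PiE {1..n} A \<in> sets (PiM {1..n} ?Z)"
      by (rule sets_PiM_I_finite) (use A in auto)
    have "emeasure (density (PiM {1..n} ?Z) (likelihood_ratio n f)) (PiE {1..n} A)
      = (\<integral>\<^sup>+ y. ennreal (likelihood_ratio n f y) * indicator (PiE {1..n} A) y \<partial>PiM {1..n} ?Z)"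
      using A' measurable_likelihood_ratio[of n f]
      by (subst emeasure_density) (auto simp: vec_space_def cong: measurable_cong_sets sets_PiM_cong)
    also have "\<dots> = (\<integral>\<^sup>+ y. (\<Prod>i\<in>{1..n}. ennreal (?r i (y i)) * indicator (A i) (y i)) \<partial>PiM {1..n} ?Z)"
    proof (rule nn_integral_cong)
      fix y assume y: "y \<in> space (PiM {1..n} ?Z)"
      \<comment> \<open>Points of the product space are extensional, so lying in the box is purely a
        coordinatewise condition.\<close>
      have "indicator (PiE {1..n} A) y = (\<Prod>i\<in>{1..n}. indicator (A i) (y i) :: ennreal)"
      proof (cases "\<forall>i\<in>{1..n}. y i \<in> A i")
        case True
        then show ?thesis using y by (auto simp: space_PiM PiE_iff)
      next
        case False
        then have "y \<notin> PiE {1..n} A" by auto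
        with False show ?thesis by (auto simp: prod_zero_iff indicator_def)
      qed
      then show "ennreal (likelihood_ratio n f y) * indicator (PiE {1..n} A) y
        = (\<Prod>i\<in>{1..n}. ennreal (?r i (y i)) * indicator (A i) (y i))"
        by (simp add: r prod_ennreal prod.distrib)
    qed
    also have "\<dots> = (\<Prod>i\<in>{1..n}. \<integral>\<^sup>+ x. ennreal (?r i x) * indicator (A i) x \<partial>?Z i)"
      by (rule Z.product_nn_integral_prod) (use A in auto)
    also have "\<dots> = (\<Prod>i\<in>{1..n}. emeasure (?M i) (A i))"
    proof (rule prod.cong[OF refl])
      fix i assume i: "i \<in> {1..n}"
      have "(\<integral>\<^sup>+ x. ennreal (?r i x) * indicator (A i) x \<partial>?Z i)
        = (\<integral>\<^sup>+ x. ennreal (normal_density 0 ?s x) * (ennreal (?r i x) * indicator (A i) x) \<partial>lborel)"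
        using i A[OF i] by (subst nn_integral_density) (auto simp: zero_vec_def)
      also have "\<dots> = (\<integral>\<^sup>+ x. ennreal (normal_density (f i) ?s x) * indicator (A i) x \<partial>lborel)"
        by (simp add: tilt ennreal_mult mult.assoc)
      also have "\<dots> = emeasure (?M i) (A i)"
        using A[OF i] by (subst emeasure_density) auto
      finally show "(\<integral>\<^sup>+ x. ennreal (?r i x) * indicator (A i) x \<partial>?Z i) = emeasure (?M i) (A i)" .
    qed
    finally show "emeasure (density (PiM {1..n} ?Z) (likelihood_ratio n f)) (PiE {1..n} A)
      = (\<Prod>i\<in>{1..n}. emeasure (?M i) (A i))" .
  qed simp
  then show ?thesis
    using assms by (simp add: gaussian_seq_eq_PiM)
qed

text \<open>The integral is the total mass of the probability measure P_f, so no Gaussian integral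
  has to be computed.\<close>

lemma likelihood_ratio_integral:
  assumes "n > 0"
  shows "integrable (gaussian_seq n (zero_vec n)) (likelihood_ratio n f)"
    and "(\<integral>y. likelihood_ratio n f y \<partial>gaussian_seq n (zero_vec n)) = 1"
proof -
  let ?P = "gaussian_seq n (zero_vec n)"
  interpret F: prob_space "gaussian_seq n f"
    by (rule prob_space_gaussian_seq[OF assms])
  have "(\<integral>\<^sup>+ y. ennreal (likelihood_ratio n f y) \<partial>?P)
      = emeasure (density ?P (likelihood_ratio n f)) (space ?P)"
    by (subst emeasure_density) (auto intro!: nn_integral_cong)
  also have "\<dots> = 1"
    using F.emeasure_space_1 by (simp add: gaussian_seq_density[OF assms, symmetric])
  finally have "has_bochner_integral ?P (likelihood_ratio n f) 1"
    by (intro has_bochner_integral_nn_integral) (auto simp: likelihood_ratio_nonneg)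
  then show "integrable ?P (likelihood_ratio n f)"
    and "(\<integral>y. likelihood_ratio n f y \<partial>?P) = 1"
    by (auto simp: has_bochner_integral_iff)
qed

lemma measure_gaussian_seq:
  assumes "n > 0" "B \<in> sets (vec_space n)"
  shows "measure (gaussian_seq n f) B
    = (\<integral>y. likelihood_ratio n f y * indicator B y \<partial>gaussian_seq n (zero_vec n))"
proof -
  have "measure (gaussian_seq n f) B = (\<integral>y. indicator B y \<partial>gaussian_seq n f)"
    using assms sets.sets_into_space[OF assms(2)] by (simp add: Int_absorb2)
  also have "\<dots> = (\<integral>y. likelihood_ratio n f y * indicator B y \<partial>gaussian_seq n (zero_vec n))"
    unfolding gaussian_seq_density[OF assms(1), of f] using assms(2)
    by (subst integral_density) (auto simp: likelihood_ratio_nonneg)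
  finally show ?thesis .
qed

text \<open>The exponential prefactor compensates the cross term of the squared norm of
  \<open>f + g\<close>. Since every ratio has mean 1 under P_0, the prefactor is the P_0-expectation
  of the product.\<close>

lemma likelihood_ratio_mult:
  "likelihood_ratio n f y * likelihood_ratio n g y
     = exp (real n * (\<Sum>i=1..n. f i * g i)) * likelihood_ratio n (\<lambda>i. f i + g i) y"
proof -
  have "(\<Sum>i=1..n. (f i + g i)\<^sup>2)
      = (\<Sum>i=1..n. (f i)\<^sup>2) + (\<Sum>i=1..n. (g i)\<^sup>2) + 2 * (\<Sum>i=1..n. f i * g i)"
    by (simp add: power2_sum sum.distrib sum_distrib_left mult.assoc)
  moreover have "(\<Sum>i=1..n. (f i + g i) * y i) = (\<Sum>i=1..n. f i * y i) + (\<Sum>i=1..n. g i * y i)"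
    by (simp add: distrib_right sum.distrib)
  ultimately show ?thesis
    by (simp add: likelihood_ratio_def mult_exp_exp algebra_simps)
qed

text \<open>Pointwise AM-GM, \<open>W - 1 \<le> \<delta>/2 + (W - 1)\<^sup>2/(2\<delta>)\<close>, replaces the Cauchy-Schwarz inequality.\<close>

lemma (in prob_space) integral_indicator_le_prob_add:
  fixes W :: "'a \<Rightarrow> real"
  assumes W [measurable]: "integrable M W" "integrable M (\<lambda>x. (W x)\<^sup>2)"
    and mean: "expectation W = 1"
    and second: "expectation (\<lambda>x. (W x)\<^sup>2) \<le> 1 + \<delta>\<^sup>2"
    and \<delta>: "\<delta> > 0" and B [measurable]: "B \<in> events"
  shows "expectation (\<lambda>x. W x * indicator B x) \<le> prob B + \<delta>"
proof -
  \<comment> \<open>On \<open>B\<close> this is the AM-GM bound for \<open>W - 1\<close>; off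
    \<open>B\<close> the left side is 0 and the added term is nonnegative.\<close>
  have pt: "W x * indicator B x \<le> indicator B x + (\<delta> / 2 + ((W x)\<^sup>2 - 2 * W x + 1) / (2 * \<delta>))" for x
  proof -
    have eq: "\<delta> / 2 + ((W x)\<^sup>2 - 2 * W x + 1) / (2 * \<delta>) - (W x - 1)
        = (W x - 1 - \<delta>)\<^sup>2 / (2 * \<delta>)"
      and eq': "(W x)\<^sup>2 - 2 * W x + 1 = (W x - 1)\<^sup>2"
      using \<delta> by (simp_all add: field_simps power2_eq_square)
    have "(W x - 1 - \<delta>)\<^sup>2 / (2 * \<delta>) \<ge> 0" "(W x - 1)\<^sup>2 / (2 * \<delta>) \<ge> 0"
      using \<delta> by simp_all
    then have "W x - 1 \<le> \<delta> / 2 + ((W x)\<^sup>2 - 2 * W x + 1) / (2 * \<delta>)"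
      and "0 \<le> \<delta> / 2 + ((W x)\<^sup>2 - 2 * W x + 1) / (2 * \<delta>)"
      using eq \<delta> unfolding eq' by linarith+
    then show ?thesis
      by (cases "x \<in> B") simp_all
  qed
  have i1: "integrable M (\<lambda>x. W x * indicator B x)"
    using integrable_real_mult_indicator[OF B W(1)] by (simp add: mult.commute)
  have iB: "integrable M (\<lambda>x. indicator B x :: real)"
    by (rule integrable_real_indicator[OF B]) (simp add: emeasure_eq_measure)
  have iQ: "integrable M (\<lambda>x. ((W x)\<^sup>2 - 2 * W x + 1) / (2 * \<delta>))"
    by (intro integrable_divide Bochner_Integration.integrable_add
        Bochner_Integration.integrable_diff W integrable_mult_right) simp_all
  have "expectation (\<lambda>x. W x * indicator B x)
      \<le> expectation (\<lambda>x. indicator B x + (\<delta> / 2 + ((W x)\<^sup>2 - 2 * W x + 1) / (2 * \<delta>)))"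
    by (intro integral_mono i1 Bochner_Integration.integrable_add iB iQ pt) simp
  also have "\<dots> = prob B + (\<delta> / 2 + (expectation (\<lambda>x. (W x)\<^sup>2) - 2 * 1 + 1) / (2 * \<delta>))"
    using W iB iQ by (simp add: mean prob_space)
  \<comment> \<open>As \<open>W\<close> has mean 1, its variance is at most
    \<open>\<delta>\<^sup>2\<close>, so each of the two added terms is at most
    \<open>\<delta> / 2\<close>.\<close>
  also have "\<dots> \<le> prob B + (\<delta> / 2 + \<delta>\<^sup>2 / (2 * \<delta>))"
    using second \<delta> by (intro add_left_mono divide_right_mono) auto
  also have "\<dots> = prob B + \<delta>"
    using \<delta> by (simp add: power2_eq_square)
  finally show ?thesis .
qed

section \<open>Random subsets of fixed size: binomial ratios and overlaps\<close>

text \<open>A uniformly random \<open>m\<close>-subset of \<open>n\<close> points contains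
  \<open>s\<close> given ones with probability \<open>m/n * (m-1)/(n-1) * ...\<close>, a product of
  \<open>s\<close> factors that are each at most \<open>m/n\<close>. The inequality is this bound
  with denominators cleared.\<close>

lemma binomial_ratio_le:
  assumes "s \<le> m" "m \<le> n"
  shows "((n - s) choose (m - s)) * n ^ s \<le> m ^ s * (n choose m)"
  using assms(1)
proof (induction s)
  case (Suc s)
  have "(m - s) * ((n - s) choose (m - s)) = (n - s) * ((n - Suc s) choose (m - Suc s))"
    using times_binomial_minus1_eq[of "m - s" "n - s"] Suc.prems by simp
  \<comment> \<open>This is \<open>(m - s)/(n - s) \<le> m/n\<close> without denominators.\<close>
  moreover have "n * (m - s) \<le> m * (n - s)"
    using assms(2) by (simp add: diff_mult_distrib2 mult.commute diff_le_mono2)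
  ultimately have "(n - s) * (n * ((n - Suc s) choose (m - Suc s))) \<le> (n - s) * (m * ((n - s) choose (m - s)))"
    using mult_le_mono1[of "n * (m - s)" "m * (n - s)" "(n - s) choose (m - s)"]
    by (simp add: ac_simps)
  \<comment> \<open>The factor \<open>n - s\<close> cancels because
    \<open>s < m \<le> n\<close>.\<close>
  then have le: "n * ((n - Suc s) choose (m - Suc s)) \<le> m * ((n - s) choose (m - s))"
    using Suc.prems assms(2) by simp
  have "((n - Suc s) choose (m - Suc s)) * n ^ Suc s = n * ((n - Suc s) choose (m - Suc s)) * n ^ s"
    by simp
  also have "\<dots> \<le> m * ((n - s) choose (m - s)) * n ^ s"
    using le by (rule mult_le_mono1)
  also have "\<dots> \<le> m * (m ^ s * (n choose m))"
    using Suc by (simp add: mult.assoc)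
  finally show ?case by simp
qed simp

text \<open>Removing \<open>S\<close> from \<open>J\<close> leaves an arbitrary subset of
  \<open>A - S\<close> with \<open>m - card S\<close> elements, and adding \<open>S\<close> back
  inverts this.\<close>

lemma card_subsets_containing:
  assumes "finite A" "S \<subseteq> A" "card S \<le> m"
  shows "card {J. S \<subseteq> J \<and> J \<subseteq> A \<and> card J = m} = (card A - card S) choose (m - card S)"
proof -
  have fS: "finite S" using assms finite_subset by blast
  have "bij_betw (\<lambda>K. K \<union> S) {K. K \<subseteq> A - S \<and> card K = m - card S}
          {J. S \<subseteq> J \<and> J \<subseteq> A \<and> card J = m}"
  proof (rule bij_betw_byWitness[where f' = "\<lambda>J. J - S"])
    have "card (K \<union> S) = m" if "K \<subseteq> A - S" "card K = m - card S" for K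
    proof -
      have "finite K" using that assms(1) finite_subset by blast
      with that assms(3) fS show ?thesis by (subst card_Un_disjoint) auto
    qed
    then show "(\<lambda>K. K \<union> S) ` {K. K \<subseteq> A - S \<and> card K = m - card S}
        \<subseteq> {J. S \<subseteq> J \<and> J \<subseteq> A \<and> card J = m}"
      using assms(2) by auto
    show "(\<lambda>J. J - S) ` {J. S \<subseteq> J \<and> J \<subseteq> A \<and> card J = m}
        \<subseteq> {K. K \<subseteq> A - S \<and> card K = m - card S}"
      using fS by (auto simp: card_Diff_subset)
  qed auto
  then have "card {J. S \<subseteq> J \<and> J \<subseteq> A \<and> card J = m} = card {K. K \<subseteq> A - S \<and> card K = m - card S}"
    by (rule bij_betw_same_card[symmetric])
  also have "\<dots> = (card A - card S) choose (m - card S)"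
    using assms fS by (simp add: n_subsets card_Diff_subset)
  finally show ?thesis .
qed

text \<open>The binomial theorem indexed by subsets rather than by sizes, so that for a power of an
  overlap the order of summation can be exchanged.\<close>

lemma power_card_eq_sum_subsets:
  fixes q :: real
  assumes "finite A"
  shows "(1 + q) ^ card A = (\<Sum>S\<in>Pow A. q ^ card S)"
  using prod_add[OF assms, of "\<lambda>_. q" "\<lambda>_. 1"] by (simp add: add.commute)

text \<open>The overlap \<open>card (I \<inter> J)\<close> is hypergeometric when \<open>J\<close> is uniform; expanding over the
  subsets of \<open>I \<inter> J\<close> compares its moment generating function with the binomial one.\<close>

lemma sum_power_overlap_le:
  fixes q :: real
  assumes "I \<subseteq> {1..n}" "card I = m" "m \<le> n" "n > 0" "q \<ge> 0"
  shows "(\<Sum>J | J \<subseteq> {1..n} \<and> card J = m. (1 + q) ^ card (I \<inter> J))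
    \<le> real (n choose m) * exp (q * (real m)\<^sup>2 / real n)"
proof -
  let ?K = "{J. J \<subseteq> {1..n} \<and> card J = m}"
  have fI: "finite I" using assms(1) finite_subset by blast
  have fK: "finite ?K" by (rule finite_subset[of _ "Pow {1..n}"]) auto
  have bound: "real (card {J \<in> ?K. S \<subseteq> J}) \<le> real (n choose m) * (real m / real n) ^ card S"
    if "S \<subseteq> I" for S
  proof -
    have s: "card S \<le> m" using card_mono[OF fI that] assms(2) by simp
    have "{J \<in> ?K. S \<subseteq> J} = {J. S \<subseteq> J \<and> J \<subseteq> {1..n} \<and> card J = m}" by auto
    then have "card {J \<in> ?K. S \<subseteq> J} = (n - card S) choose (m - card S)"
      using card_subsets_containing[of "{1..n}" S m] that assms(1) s by simp
    then have "card {J \<in> ?K. S \<subseteq> J} * n ^ card S \<le> m ^ card S * (n choose m)"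
      using binomial_ratio_le[OF s assms(3)] by simp
    then have "real (card {J \<in> ?K. S \<subseteq> J}) * real n ^ card S \<le> real m ^ card S * real (n choose m)"
      unfolding of_nat_power[symmetric] of_nat_mult[symmetric] of_nat_le_iff .
    then show ?thesis
      using assms(4) by (simp add: power_divide pos_le_divide_eq mult.commute)
  qed
  have "(\<Sum>J\<in>?K. (1 + q) ^ card (I \<inter> J)) = (\<Sum>J\<in>?K. \<Sum>S\<in>Pow (I \<inter> J). q ^ card S)"
    using fI by (simp add: power_card_eq_sum_subsets)
  also have "\<dots> = (\<Sum>J\<in>?K. \<Sum>S\<in>{S \<in> Pow I. S \<subseteq> J}. q ^ card S)"
    by (intro sum.cong refl) auto
  also have "\<dots> = (\<Sum>S\<in>Pow I. \<Sum>J\<in>{J \<in> ?K. S \<subseteq> J}. q ^ card S)"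
    using fI fK by (intro sum.swap_restrict) auto
  also have "\<dots> = (\<Sum>S\<in>Pow I. real (card {J \<in> ?K. S \<subseteq> J}) * q ^ card S)"
    by simp
  also have "\<dots> \<le> (\<Sum>S\<in>Pow I. real (n choose m) * (real m / real n) ^ card S * q ^ card S)"
    using bound assms(5) by (intro sum_mono mult_right_mono) auto
  \<comment> \<open>Up to the factor \<open>n choose m\<close>, summing back over the subsets of
    \<open>I\<close> gives the moment generating function of a binomial variable with parameters
    \<open>m\<close> and \<open>m/n\<close>, with \<open>1 + q\<close> in the role of
    \<open>exp t\<close>.\<close>
  also have "\<dots> = real (n choose m) * (1 + q * real m / real n) ^ m"
    using power_card_eq_sum_subsets[OF fI, of "q * real m / real n"] assms(2)
    by (simp add: sum_distrib_left power_mult_distrib power_divide mult_ac)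
  also have "\<dots> \<le> real (n choose m) * exp (q * real m / real n) ^ m"
    using assms(5) by (intro mult_left_mono power_mono exp_ge_add_one_self) auto
  also have "exp (q * real m / real n) ^ m = exp (q * (real m)\<^sup>2 / real n)"
    by (simp add: exp_of_nat_mult[symmetric] power2_eq_square mult_ac)
  finally show ?thesis .
qed


section \<open>Spike vectors and the second moment of their uniform mixture\<close>

text \<open>The restriction to \<open>{1..n}\<close> keeps the vector extensional, hence a point of
  the space of \<open>vec_space n\<close>.\<close>

definition spike :: "nat \<Rightarrow> real \<Rightarrow> nat set \<Rightarrow> nat \<Rightarrow> real" where
  "spike n \<theta> I = (\<lambda>i\<in>{1..n}. if i \<in> I then \<theta> else 0)"

lemma spike_inner:
  assumes "I \<subseteq> {1..n}"
  shows "(\<Sum>i=1..n. spike n \<theta> I i * spike n \<theta> J i) = \<theta>\<^sup>2 * real (card (I \<inter> J))"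
proof -
  have "(\<Sum>i=1..n. spike n \<theta> I i * spike n \<theta> J i) = (\<Sum>i\<in>{1..n}. if i \<in> I \<inter> J then \<theta>\<^sup>2 else 0)"
    by (intro sum.cong refl) (auto simp: spike_def power2_eq_square)
  also have "\<dots> = (\<Sum>i\<in>{1..n} \<inter> (I \<inter> J). \<theta>\<^sup>2)"
    by (rule sum.inter_restrict[symmetric]) simp
  also have "{1..n} \<inter> (I \<inter> J) = I \<inter> J" using assms by auto
  finally show ?thesis by simp
qed

lemma spike_sum:
  assumes "I \<subseteq> {1..n}"
  shows "sum_functional n (spike n \<theta> I) = real (card I) * \<theta>"
proof -
  have "sum_functional n (spike n \<theta> I) = (\<Sum>i\<in>{1..n}. if i \<in> I then \<theta> else 0)"
    unfolding sum_functional_def by (intro sum.cong refl) (auto simp: spike_def)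
  also have "\<dots> = (\<Sum>i\<in>{1..n} \<inter> I. \<theta>)"
    by (rule sum.inter_restrict[symmetric]) simp
  also have "{1..n} \<inter> I = I" using assms by auto
  finally show ?thesis by simp
qed

lemma spike_sparse:
  assumes "I \<subseteq> {1..n}" "card I \<le> m"
  shows "spike n \<theta> I \<in> sparse_vecs n m"
proof -
  have "{i \<in> {1..n}. spike n \<theta> I i \<noteq> 0} \<subseteq> I" by (auto simp: spike_def split: if_splits)
  then have "l0_norm n (spike n \<theta> I) \<le> card I"
    unfolding l0_norm_def using assms(1) by (intro card_mono) (auto intro: finite_subset)
  then show ?thesis
    using assms(2) by (auto simp: sparse_vecs_def vec_space_def spike_def space_PiM)
qed

text \<open>Lets the facts about spikes serve the zero signal as well.\<close>

lemma zero_vec_eq_spike: "zero_vec n = spike n \<theta> {}"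
  by (auto simp: zero_vec_def spike_def)

text \<open>\<open>W\<close> is the likelihood ratio of the uniform spike mixture against P_0, so
  this controls the chi-square divergence, the second moment minus 1. Squaring gives a double sum
  over supports, and each pair contributes only through its overlap.\<close>

lemma mixture_second_moment:
  fixes n m :: nat and \<theta> :: real
  defines "K \<equiv> {I. I \<subseteq> {1..n} \<and> card I = m}"
  defines "W \<equiv> (\<lambda>y. (\<Sum>I\<in>K. likelihood_ratio n (spike n \<theta> I) y) / real (n choose m))"
  assumes "n > 0" "m \<le> n"
  shows "integrable (gaussian_seq n (zero_vec n)) (\<lambda>y. (W y)\<^sup>2)"
    and "(\<integral>y. (W y)\<^sup>2 \<partial>gaussian_seq n (zero_vec n))
      \<le> exp ((exp (real n * \<theta>\<^sup>2) - 1) * (real m)\<^sup>2 / real n)"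
proof -
  let ?P = "gaussian_seq n (zero_vec n)"
  let ?L = "\<lambda>I. likelihood_ratio n (spike n \<theta> I)"
  let ?k = "real (n choose m)"
  let ?E = "exp ((exp (real n * \<theta>\<^sup>2) - 1) * (real m)\<^sup>2 / real n)"
  have kpos: "?k > 0" using assms(4) by (simp add: zero_less_binomial)
  have cK: "real (card K) = ?k" by (simp add: K_def n_subsets)
  have W2: "(W y)\<^sup>2 = (\<Sum>I\<in>K. \<Sum>J\<in>K. ?L I y * ?L J y) / ?k\<^sup>2" for y
    by (simp add: W_def power_divide power2_eq_square sum_product)
  have int: "integrable ?P (\<lambda>y. ?L I y * ?L J y)"
    and val: "(\<integral>y. ?L I y * ?L J y \<partial>?P) = exp (real n * (\<theta>\<^sup>2 * real (card (I \<inter> J))))"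
    if "I \<in> K" for I J
    using likelihood_ratio_integral[OF assms(3)] that spike_inner[of I n \<theta> J]
    by (simp_all add: likelihood_ratio_mult K_def)
  show "integrable ?P (\<lambda>y. (W y)\<^sup>2)"
    unfolding W2 by (intro integrable_divide Bochner_Integration.integrable_sum int)
  have "(\<integral>y. (W y)\<^sup>2 \<partial>?P)
      = (\<Sum>I\<in>K. \<Sum>J\<in>K. exp (real n * (\<theta>\<^sup>2 * real (card (I \<inter> J))))) / ?k\<^sup>2"
    unfolding W2 using int by (simp add: Bochner_Integration.integral_sum val)
  \<comment> \<open>The form \<open>1 + q\<close> with
    \<open>q = exp (real n * \<theta>\<^sup>2) - 1\<close> is the one that
    \<open>sum_power_overlap_le\<close> accepts.\<close>
  also have "\<dots> = (\<Sum>I\<in>K. \<Sum>J\<in>K. (1 + (exp (real n * \<theta>\<^sup>2) - 1)) ^ card (I \<inter> J)) / ?k\<^sup>2"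
    by (simp add: exp_of_nat_mult[symmetric] mult_ac)
  also have "\<dots> \<le> (\<Sum>I\<in>K. ?k * ?E) / ?k\<^sup>2"
  proof (intro divide_right_mono sum_mono)
    fix I assume "I \<in> K"
    then show "(\<Sum>J\<in>K. (1 + (exp (real n * \<theta>\<^sup>2) - 1)) ^ card (I \<inter> J)) \<le> ?k * ?E"
      unfolding K_def using assms(3,4) by (intro sum_power_overlap_le) auto
  qed simp
  also have "\<dots> = ?E"
    using kpos cK by (simp add: power2_eq_square)
  finally show "(\<integral>y. (W y)\<^sup>2 \<partial>?P) \<le> ?E" .
qed

section \<open>From coverage at zero and at the spikes to expected length\<close>

lemma confidence_interval_coverage:
  assumes "CI \<in> confidence_intervals n T \<alpha> G" "f \<in> G"
  shows "measure (gaussian_seq n f) {y \<in> space (vec_space n). T f \<in> CI y} \<ge> 1 - \<alpha>"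
proof -
  have "1 - \<alpha> \<le> (INF f\<in>G. measure (gaussian_seq n f) {y \<in> space (vec_space n). T f \<in> CI y})"
    using assms(1) by (simp add: confidence_intervals_def)
  also have "\<dots> \<le> measure (gaussian_seq n f) {y \<in> space (vec_space n). T f \<in> CI y}"
    using assms(2) by (intro cINF_lower bdd_belowI2[of _ 0]) auto
  finally show ?thesis .
qed

text \<open>Coverage at zero costs \<alpha>, coverage averaged over the spikes costs another
  \<alpha>, and replacing the mixture by P_0 costs \<delta>, because \<open>chi\<close> bounds the
  second moment by \<open>1 + \<delta>\<^sup>2\<close>. With at least the remaining probability, 0
  and \<open>real m * \<theta>\<close> lie in the same interval.\<close>

lemma expected_length_lower_bound:
  fixes n m :: nat and \<alpha> \<delta> \<theta> :: real
  assumes CI: "CI \<in> confidence_intervals n (sum_functional n) \<alpha> (sparse_vecs n m)"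
    and n: "n > 0" "m \<le> n" and \<theta>: "\<theta> \<ge> 0" and \<delta>: "\<delta> > 0"
    and chi: "exp ((exp (real n * \<theta>\<^sup>2) - 1) * (real m)\<^sup>2 / real n) \<le> 1 + \<delta>\<^sup>2"
  shows "(\<integral>\<^sup>+ y. interval_length (CI y) \<partial>gaussian_seq n (zero_vec n))
    \<ge> ennreal ((1 - 2 * \<alpha> - \<delta>) * (real m * \<theta>))"
proof -
  let ?P = "gaussian_seq n (zero_vec n)"
  let ?k = "real (n choose m)"
  define \<mu> where "\<mu> = real m * \<theta>"
  have \<mu>: "\<mu> \<ge> 0" using \<theta> by (simp add: \<mu>_def)
  define K where "K = {I. I \<subseteq> {1..n} \<and> card I = m}"
  define W where "W = (\<lambda>y. (\<Sum>I\<in>K. likelihood_ratio n (spike n \<theta> I) y) / ?k)"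
  define A where "A = {y \<in> space (vec_space n). 0 \<in> CI y}"
  define B where "B = {y \<in> space (vec_space n). \<mu> \<in> CI y}"
  interpret prob_space ?P by (rule prob_space_gaussian_seq[OF n(1)])
  have kpos: "?k > 0" using n(2) by (simp add: zero_less_binomial)
  have cK: "real (card K) = ?k" by (simp add: K_def n_subsets)
  have ivl: "is_interval (CI y)" if "y \<in> space (vec_space n)" for y
    using CI that by (simp add: confidence_intervals_def data_intervals_def)
  have AB: "A \<in> sets (vec_space n)" "B \<in> sets (vec_space n)"
    using CI by (simp_all add: confidence_intervals_def data_intervals_def A_def B_def)
  then have ev: "A \<in> events" "B \<in> events" by (simp_all add: sets_gaussian_seq)
  have L: "integrable ?P (likelihood_ratio n f)" "expectation (likelihood_ratio n f) = 1" for f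
    using likelihood_ratio_integral[OF n(1)] by auto
  \<comment> \<open>The zero vector enters as the spike with empty support, whose functional is
    0.\<close>
  have pA: "1 - \<alpha> \<le> prob A"
    using confidence_interval_coverage[OF CI spike_sparse[of "{}" n m 0]]
      spike_sum[of "{}" n 0] by (simp add: A_def flip: zero_vec_eq_spike)
  have W1: "integrable ?P W" "expectation W = 1"
    unfolding W_def using L kpos cK by (simp_all add: Bochner_Integration.integral_sum)
  \<comment> \<open>Every spike in the prior has the same functional value \<open>\<mu>\<close>, so
    all coverage statements concern the one event \<open>B\<close> and can be averaged.\<close>
  have "1 - \<alpha> \<le> expectation (\<lambda>y. W y * indicator B y)"
  proof -
    have iL: "integrable ?P (\<lambda>y. likelihood_ratio n f y * indicator B y)" for f
      using integrable_real_mult_indicator[OF ev(2) L(1)] by (simp add: mult.commute)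
    have "1 - \<alpha> = (\<Sum>I\<in>K. 1 - \<alpha>) / ?k" using kpos cK by simp
    also have "\<dots> \<le> (\<Sum>I\<in>K. measure (gaussian_seq n (spike n \<theta> I)) B) / ?k"
    proof (intro divide_right_mono sum_mono)
      fix I assume I: "I \<in> K"
      then have "spike n \<theta> I \<in> sparse_vecs n m" "sum_functional n (spike n \<theta> I) = \<mu>"
        by (auto simp: K_def \<mu>_def spike_sum intro!: spike_sparse)
      then show "1 - \<alpha> \<le> measure (gaussian_seq n (spike n \<theta> I)) B"
        using confidence_interval_coverage[OF CI] unfolding B_def by metis
    qed simp
    also have "\<dots> = expectation (\<lambda>y. (\<Sum>I\<in>K. likelihood_ratio n (spike n \<theta> I) y * indicator B y) / ?k)"
      using iL by (simp add: measure_gaussian_seq[OF n(1) AB(2)] Bochner_Integration.integral_sum)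
    also have "\<dots> = expectation (\<lambda>y. W y * indicator B y)"
      by (simp add: W_def sum_distrib_right)
    finally show ?thesis .
  qed
  also have "\<dots> \<le> prob B + \<delta>"
    using mixture_second_moment[OF n, of \<theta>] chi
    by (intro integral_indicator_le_prob_add W1 ev(2) \<delta>) (simp_all add: W_def K_def)
  finally have pB: "1 - \<alpha> - \<delta> \<le> prob B" by simp
  have "prob (A \<union> B) = prob A + prob B - prob (A \<inter> B)"
    using ev by (intro measure_Un3) (simp_all add: fmeasurable_eq_sets)
  moreover have "prob (A \<union> B) \<le> 1" by simp
  ultimately have pAB: "1 - 2 * \<alpha> - \<delta> \<le> prob (A \<inter> B)" using pA pB by simp
  have "ennreal ((1 - 2 * \<alpha> - \<delta>) * \<mu>) \<le> ennreal (\<mu> * prob (A \<inter> B))"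
    using pAB \<mu> by (intro ennreal_leI) (simp add: mult.commute mult_left_mono)
  also have "\<dots> = (\<integral>\<^sup>+ y. ennreal \<mu> * indicator (A \<inter> B) y \<partial>?P)"
    using ev \<mu> by (subst nn_integral_cmult_indicator) (auto simp: emeasure_eq_measure ennreal_mult)
  also have "\<dots> \<le> (\<integral>\<^sup>+ y. interval_length (CI y) \<partial>?P)"
  proof (rule nn_integral_mono)
    fix y assume "y \<in> space ?P"
    then have iv: "is_interval (CI y)" using ivl by simp
    show "ennreal \<mu> * indicator (A \<inter> B) y \<le> interval_length (CI y)"
    proof (cases "y \<in> A \<inter> B")
      case True
      then have "{0..\<mu>} \<subseteq> CI y"
        using iv by (auto simp: A_def B_def is_interval_1)
      then have "emeasure lborel {0..\<mu>} \<le> emeasure lborel (CI y)"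
        using real_interval_borel_measurable[OF iv] by (intro emeasure_mono) simp_all
      then show ?thesis
        using True \<mu> by (simp add: interval_length_def)
    qed simp
  qed
  finally show ?thesis by (simp add: \<mu>_def)
qed

section \<open>The modulus of continuity over sparse vectors\<close>

text \<open>The difference of two \<open>m\<close>-sparse vectors is supported on at most
  \<open>2 * m\<close> coordinates; Cauchy-Schwarz on that set gives the factor.\<close>

lemma modulus_sparse_le:
  assumes "\<epsilon> \<ge> 0"
  shows "modulus n (sum_functional n) \<epsilon> (sparse_vecs n m) \<le> sqrt (2 * real m) * \<epsilon>"
  unfolding modulus_def
proof (rule cSup_least[OF modulus_set_nonempty[OF assms]], safe)
  fix f g
  assume f: "f \<in> sparse_vecs n m" and g: "g \<in> sparse_vecs n m"
    and le: "L2_set (\<lambda>i. g i - f i) {1..n} \<le> \<epsilon>"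
  let ?S = "\<lambda>h. {i \<in> {1..n}. h i \<noteq> (0::real)}"
  let ?D = "?S f \<union> ?S g"
  have "card ?D \<le> card (?S f) + card (?S g)" by (rule card_Un_le)
  also have "\<dots> \<le> 2 * m" using f g by (simp add: sparse_vecs_def l0_norm_def)
  finally have D: "card ?D \<le> 2 * m" .
  have "sum_functional n g - sum_functional n f = (\<Sum>i=1..n. g i - f i)"
    by (simp add: sum_functional_def sum_subtractf)
  also have "\<dots> = (\<Sum>i\<in>?D. g i - f i)"
    by (rule sum.mono_neutral_right) auto
  also have "\<dots> \<le> (\<Sum>i\<in>?D. \<bar>1\<bar> * \<bar>g i - f i\<bar>)"
    by (intro sum_mono) simp
  also have "\<dots> \<le> L2_set (\<lambda>_. 1) ?D * L2_set (\<lambda>i. g i - f i) ?D"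
    by (rule L2_set_mult_ineq)
  also have "\<dots> \<le> sqrt (2 * real m) * \<epsilon>"
  proof (rule mult_mono)
    show "L2_set (\<lambda>_. 1) ?D \<le> sqrt (2 * real m)"
      using D by (simp add: L2_set_def)
    have "L2_set (\<lambda>i. g i - f i) ?D \<le> L2_set (\<lambda>i. g i - f i) {1..n}"
      unfolding L2_set_def by (intro real_sqrt_le_mono sum_mono2) auto
    then show "L2_set (\<lambda>i. g i - f i) ?D \<le> \<epsilon>" using le by simp
  qed simp_all
  finally show "sum_functional n g - sum_functional n f \<le> sqrt (2 * real m) * \<epsilon>" .
qed

text \<open>These facts make \<open>ln (n / m^2)\<close> positive, let the second moment exponent
  \<open>m / sqrt n\<close> decay, and control \<open>ln n\<close> by
  \<open>ln (n / m^2)\<close>.\<close>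

lemma sparsity_bounds:
  fixes n m :: nat and \<gamma> :: real
  assumes "n > 0" "m > 0" "real m < real n powr \<gamma>" "\<gamma> < 1/2"
  shows "m \<le> n" "(real m)\<^sup>2 < real n" "real m / sqrt (real n) \<le> real n powr (\<gamma> - 1/2)"
    and "(1 - 2 * \<gamma>) * ln (real n) \<le> ln (real n / (real m)\<^sup>2)"
proof -
  have "real m < real n powr \<gamma>" by fact
  also have "\<dots> \<le> real n powr (1/2)" using assms by (intro powr_mono) auto
  finally have lt: "real m < sqrt (real n)" by (simp add: powr_half_sqrt)
  then have "(real m)\<^sup>2 < (sqrt (real n))\<^sup>2" by (intro power_strict_mono) auto
  then show sq: "(real m)\<^sup>2 < real n" by simp
  have "m \<le> m\<^sup>2" by (simp add: power2_nat_le_imp_le power2_eq_square)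
  moreover have "m\<^sup>2 < n" using sq by (simp flip: of_nat_power)
  ultimately show "m \<le> n" by simp
  show "real m / sqrt (real n) \<le> real n powr (\<gamma> - 1/2)"
    using assms by (simp add: powr_diff powr_half_sqrt divide_right_mono)
  \<comment> \<open>Taking logarithms in \<open>m < n powr \<gamma>\<close> bounds the subtracted
    term in \<open>ln (n / m^2) = ln n - 2 * ln m\<close>.\<close>
  have "ln (real m) \<le> \<gamma> * ln (real n)"
    using assms ln_less_cancel_iff[of "real m" "real n powr \<gamma>"] by (simp add: ln_powr)
  then show "(1 - 2 * \<gamma>) * ln (real n) \<le> ln (real n / (real m)\<^sup>2)"
    using assms by (simp add: ln_div ln_realpow algebra_simps)
qed

text \<open>Three bounds are chained: the modulus is at most \<open>sqrt (2 * m)\<close> times the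
  radius, \<open>n choose m\<close> is at most \<open>n ^ m\<close>, and
  \<open>(1 - 2 * \<gamma>) * ln n\<close> is at most \<open>ln (n / m^2)\<close>. The constant in
  front absorbs the loss in the last one.\<close>

lemma modulus_rate_le:
  fixes n m :: nat and \<gamma> :: real
  assumes "n > 0" "m > 0" "real m < real n powr \<gamma>" "\<gamma> < 1/2"
  shows "sqrt (1/4 - \<gamma>/2)
      * modulus n (sum_functional n) (sqrt (ln (real (n choose m))) / sqrt (real n)) (sparse_vecs n m)
    \<le> real m / sqrt (real n) * sqrt (1/2 * ln (real n / (real m)\<^sup>2))"
proof -
  let ?l = "ln (real (n choose m))"
  note b = sparsity_bounds[OF assms]
  \<comment> \<open>This makes the logarithm, and so the radius given to
    \<open>modulus_sparse_le\<close>, nonnegative.\<close>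
  have k: "1 \<le> real (n choose m)" using b(1) by (simp add: Suc_leI zero_less_binomial)
  have "real (n choose m) \<le> real n ^ m"
    using binomial_le_pow[OF b(1)] by (metis of_nat_le_iff of_nat_power)
  then have "?l \<le> ln (real n ^ m)" using k b(1) by (intro ln_mono) auto
  then have l: "0 \<le> ?l" "?l \<le> real m * ln (real n)"
    using k assms(1) by (simp_all add: ln_realpow)
  have "sqrt (1/4 - \<gamma>/2)
      * modulus n (sum_functional n) (sqrt ?l / sqrt (real n)) (sparse_vecs n m)
    \<le> sqrt (1/4 - \<gamma>/2) * (sqrt (2 * real m) * (sqrt ?l / sqrt (real n)))"
    using assms(4) l by (intro mult_left_mono modulus_sparse_le) auto
  \<comment> \<open>Here \<open>2 * (1/4 - \<gamma>/2) = 1/2 - \<gamma>\<close>, which is half of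
    the factor \<open>1 - 2 * \<gamma>\<close> in \<open>sparsity_bounds\<close>.\<close>
  also have "\<dots> = sqrt (real m * ((1/2 - \<gamma>) * ?l)) / sqrt (real n)"
    by (simp add: real_sqrt_mult[symmetric] algebra_simps)
  also have "\<dots> \<le> sqrt ((real m)\<^sup>2 * (1/2 * ln (real n / (real m)\<^sup>2))) / sqrt (real n)"
  proof (intro divide_right_mono real_sqrt_le_mono)
    have "(1/2 - \<gamma>) * ?l \<le> (1/2 - \<gamma>) * (real m * ln (real n))"
      using l assms(4) by (intro mult_left_mono) auto
    also have "\<dots> = real m * (1/2 * ((1 - 2 * \<gamma>) * ln (real n)))"
      by (simp add: algebra_simps)
    also have "\<dots> \<le> real m * (1/2 * ln (real n / (real m)\<^sup>2))"
      using b(4) by (intro mult_left_mono) auto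
    finally show "real m * ((1/2 - \<gamma>) * ?l) \<le> (real m)\<^sup>2 * (1/2 * ln (real n / (real m)\<^sup>2))"
      by (simp only: power2_eq_square mult.assoc) (intro mult_left_mono, auto)
  qed simp
  also have "\<dots> = real m / sqrt (real n) * sqrt (1/2 * ln (real n / (real m)\<^sup>2))"
    by (simp add: real_sqrt_mult real_sqrt_divide)
  finally show ?thesis .
qed

section \<open>Calibration of the spike height for large \<open>n\<close>\<close>

theorem proposition5:
  fixes m :: "nat \<Rightarrow> nat" and \<alpha> \<gamma> :: real
  assumes m_pos: "\<And>n. n \<ge> 4 \<Longrightarrow> m n > 0"
    and m_less: "\<And>n. n \<ge> 4 \<Longrightarrow> real (m n) < real n powr \<gamma>"
    and gamma: "\<gamma> < 1/2"
    and alpha: "0 < \<alpha>" "\<alpha> < 1/2"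
  shows "\<forall>\<^sub>F n in sequentially.
    \<forall>CI \<in> confidence_intervals n (sum_functional n) \<alpha> (sparse_vecs n (m n)).
      (\<integral>\<^sup>+ y. interval_length (CI y) \<partial>gaussian_seq n (zero_vec n))
        \<ge> ennreal ((1/2 - \<alpha>) * (real (m n) / sqrt (real n))
                    * sqrt (1/2 * ln (real n / (real (m n))\<^sup>2))) \<and>
      (1/2 - \<alpha>) * (real (m n) / sqrt (real n)) * sqrt (1/2 * ln (real n / (real (m n))\<^sup>2))
        \<ge> (1/2 - \<alpha>) * sqrt (1/4 - \<gamma>/2)
            * modulus n (sum_functional n) (sqrt (ln (real (n choose m n))) / sqrt (real n))
                (sparse_vecs n (m n))"
proof -
  \<comment> \<open>Half of \<open>1 - 2 * \<alpha>\<close>: spending it on the change of measure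
    leaves \<open>1 - 2 * \<alpha> - \<delta> = 1/2 - \<alpha>\<close>, the constant
    required.\<close>
  define \<delta> where "\<delta> = 1/2 - \<alpha>"
  have \<delta>: "\<delta> > 0" using alpha by (simp add: \<delta>_def)
  \<comment> \<open>The exponent is negative since \<open>\<gamma> < 1/2\<close>; this power of
    \<open>n\<close> will dominate the exponent in the second moment bound.\<close>
  have "((\<lambda>n. real n powr (\<gamma> - 1/2)) \<longlongrightarrow> 0) sequentially"
    using gamma by (intro tendsto_neg_powr filterlim_real_sequentially) simp
  then have "((\<lambda>n. exp (real n powr (\<gamma> - 1/2))) \<longlongrightarrow> exp 0) sequentially"
    by (intro tendsto_exp)
  then have "\<forall>\<^sub>F n in sequentially. exp (real n powr (\<gamma> - 1/2)) < 1 + \<delta>\<^sup>2"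
    using \<delta> by (intro order_tendstoD(2)) auto
  with eventually_ge_at_top[of 4] show ?thesis
  proof eventually_elim
    case (elim n)
    have n: "n > 0" using elim by simp
    note par = n m_pos[OF elim(1)] m_less[OF elim(1)] gamma
    note b = sparsity_bounds[OF par]
    define M where "M = real (m n)"
    \<comment> \<open>Chosen so that
      \<open>exp (real n * \<theta>\<^sup>2) = sqrt (real n) / M\<close>. The second moment exponent
      is then at most \<open>M / sqrt (real n)\<close>, and \<open>M * \<theta>\<close> is the
      claimed length up to the factor \<open>1/2 - \<alpha>\<close>.\<close>
    define \<theta> where "\<theta> = sqrt (1/2 * ln (real n / M\<^sup>2)) / sqrt (real n)"
    have M: "M > 0" using par by (simp add: M_def)
    \<comment> \<open>Positivity of the logarithm is what lets squaring undo \<open>sqrt\<close> in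
      \<open>\<theta>\<close>, and it makes \<open>\<theta>\<close> nonnegative.\<close>
    have ratio: "real n / M\<^sup>2 > 1"
      using b(2) M by (simp add: M_def)
    have "real n * \<theta>\<^sup>2 = 1/2 * ln (real n / M\<^sup>2)"
      using ratio n by (simp add: \<theta>_def power_divide)
    also have "\<dots> = ln (sqrt (real n / M\<^sup>2))"
      using ratio by (simp add: ln_sqrt)
    finally have "exp (real n * \<theta>\<^sup>2) = sqrt (real n / M\<^sup>2)"
      using ratio by (metis exp_ln less_trans real_sqrt_gt_zero zero_less_one)
    also have "\<dots> = sqrt (real n) / M"
      using M by (simp add: real_sqrt_divide)
    finally have "(exp (real n * \<theta>\<^sup>2) - 1) * M\<^sup>2 / real n = (sqrt (real n) / M - 1) * M\<^sup>2 / real n"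
      by simp
    also have "\<dots> \<le> sqrt (real n) / M * M\<^sup>2 / real n"
      by (intro divide_right_mono mult_right_mono) auto
    also have "\<dots> = M / sqrt (real n)"
      using M n by (simp add: power2_eq_square field_simps)
    also have "\<dots> \<le> real n powr (\<gamma> - 1/2)" using b(3) by (simp add: M_def)
    finally have "exp ((exp (real n * \<theta>\<^sup>2) - 1) * (real (m n))\<^sup>2 / real n) \<le> 1 + \<delta>\<^sup>2"
      using elim(2) by (simp add: M_def) (meson exp_le_cancel_iff less_imp_le order_trans)
    then have "ennreal ((1 - 2 * \<alpha> - \<delta>) * (real (m n) * \<theta>))
        \<le> (\<integral>\<^sup>+ y. interval_length (CI y) \<partial>gaussian_seq n (zero_vec n))"
      if "CI \<in> confidence_intervals n (sum_functional n) \<alpha> (sparse_vecs n (m n))" for CI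
      using that n b(1) \<delta> ratio by (intro expected_length_lower_bound) (auto simp: \<theta>_def)
    moreover have "(1 - 2 * \<alpha> - \<delta>) * (real (m n) * \<theta>)
        = (1/2 - \<alpha>) * (real (m n) / sqrt (real n)) * sqrt (1/2 * ln (real n / (real (m n))\<^sup>2))"
      by (simp add: \<delta>_def \<theta>_def M_def)
    moreover have "(1/2 - \<alpha>) * sqrt (1/4 - \<gamma>/2)
            * modulus n (sum_functional n) (sqrt (ln (real (n choose m n))) / sqrt (real n))
                (sparse_vecs n (m n))
        \<le> (1/2 - \<alpha>) * (real (m n) / sqrt (real n)) * sqrt (1/2 * ln (real n / (real (m n))\<^sup>2))"
      using mult_left_mono[OF modulus_rate_le[OF par], of "1/2 - \<alpha>"] alpha
      by (simp only: mult.assoc)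
    ultimately show ?case by simp
  qed
qed

end
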